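(* Let $\mathcal{T}_0$ be a first-order theory with signature $\Pi_0=(\Sigma_0,\mathsf{Pred})$, and let $\mathcal{T}_1=\mathcal{T}_0\cup\mathcal{K}_1$ and $\mathcal{T}_2=\mathcal{T}_0\cup\mathcal{K}_2$ be two extensions of $\mathcal{T}_0$ with signatures $\Pi_1=(\Sigma_0\cup\Sigma_1,\mathsf{Pred})$ and $\Pi_2=(\Sigma_0\cup\Sigma_2,\mathsf{Pred})$ respectively ($\Sigma_1,\Sigma_2$ sets of new function symbols, $\mathcal{K}_i$ sets of clauses over $\Pi_i$). Assume that both extensions $\mathcal{T}_0\subseteq\mathcal{T}_1$ and $\mathcal{T}_0\subseteq\mathcal{T}_2$ satisfy condition $(\mathsf{Comp_w})$, and that $\Sigma_1\cap\Sigma_2=\emptyset$. Then the extension $\mathcal{T}_0\subseteq\mathcal{T}=\mathcal{T}_0\cup\mathcal{K}_1\cup\mathcal{K}_2$ (with extension symbols $\Sigma_1\cup\Sigma_2$) satisfies $(\mathsf{Comp_w})$. If, additionally, for $i=1,2$ all terms in $\mathcal{K}_i$ starting with a function symbol in $\Sigma_i$ are flat and linear, then the extension $\mathcal{T}_0\subseteq\mathcal{T}$ is local.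
   Context: A partial structure over $(\Sigma,\mathsf{Pred})$ is a nonempty set with partial functions for the symbols of $\Sigma$ and relations for $\mathsf{Pred}$. Terms evaluate under an assignment as usual, and are undefined if some subterm is undefined or a function is applied outside its domain. Weak satisfaction: an (in)equation $s\approx t$ / $s\not\approx t$ or (negated) atom $P(\bar t)$ holds weakly if all involved terms are defined and the literal is true, or if at least one involved term is undefined; a clause holds weakly under an assignment if some literal does, and in the structure if this holds for all assignments. A weak embedding $i:A\to B$ is an injective total map such that whenever $f_A(\bar a)$ is defined, $f_B(i(\bar a))$ is defined and equals $i(f_A(\bar a))$, and predicates are preserved and reflected. For an extension $\mathcal{T}_0\subseteq\mathcal{T}_0\cup\mathcal{K}$ of a theory with signature $\Pi_0=(\Sigma_0,\mathsf{Pred})$ by new function symbols $\Sigma'$ and clauses $\mathcal{K}$: a weak partial model is a partial structure over $(\Sigma_0\cup\Sigma',\mathsf{Pred})$ whose $\Pi_0$-reduct is a total model of $\mathcal{T}_0$ and which weakly satisfies $\mathcal{K}$. Condition $(\mathsf{Comp_w})$: every weak partial model $A$ weakly embeds into a total model $B$ of $\mathcal{T}_0\cup\mathcal{K}$ such that the $\Pi_0$-reducts of $A$ and $B$ are isomorphic. Locality: for a set $G$ of ground clauses (over the signature with additional constants), $\mathsf{st}(\mathcal{K},G)$ is the set of ground subterms of $\mathcal{K}$ and $G$, and $\mathcal{K}[G]$ is the set of instances of $\mathcal{K}$ in which every term starting with a symbol of $\Sigma'$ is a ground term in $\mathsf{st}(\mathcal{K},G)$. The extension is local if for every finite set $G$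 of ground clauses, $\mathcal{T}_0\cup\mathcal{K}\cup G\models\bot$ iff $\mathcal{T}_0\cup\mathcal{K}[G]\cup G$ has no weak partial model in which all terms of $\mathsf{st}(\mathcal{K},G)$ are defined. "Flat and linear" for the terms starting with a symbol of $\Sigma_i$: no function symbol (including constants) occurs as an argument of a $\Sigma_i$-symbol; whenever a variable occurs in two terms starting with $\Sigma_i$-symbols those terms are identical; and no term starting with a $\Sigma_i$-symbol contains two occurrences of the same variable.
   Formalization: Condition (Comp_w) is taken to require that the weak embedding of A into B is itself an isomorphism of the Π₀-reducts; with an unrelated isomorphism the claim fails, e.g. T₀=Th(ω,s,<), K₁={s(c')≈c}, K₂={¬x<e}. *)

theory Defs
  imports Main
begin

record ('f, 'p) signature =
  funs :: "'f set"
  farity :: "'f \<Rightarrow> nat"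
  preds :: "'p set"
  parity :: "'p \<Rightarrow> nat"

definition sig_extend :: "('f, 'p) signature \<Rightarrow> 'f set \<Rightarrow> ('f, 'p) signature" where
  "sig_extend \<Pi> \<Sigma> = \<Pi>\<lparr>funs := funs \<Pi> \<union> \<Sigma>\<rparr>"


subsection \<open>Terms, clauses, formulas\<close>

datatype 'f trm = Var nat | App 'f "'f trm list"

datatype ('f, 'p) literal =
    Eq "'f trm" "'f trm"
  | Neq "'f trm" "'f trm"
  | Pos 'p "'f trm list"
  | Neg 'p "'f trm list"

type_synonym ('f, 'p) clause = "('f, 'p) literal list"

datatype ('f, 'p) form =
    Falsum
  | Equal "'f trm" "'f trm"
  | Rel 'p "'f trm list"
  | Imp "('f, 'p) form" "('f, 'p) form"
  | Forall nat "('f, 'p) form"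

text \<open>The list of variable occurrences, from left to right.\<close>
fun var_occs :: "'f trm \<Rightarrow> nat list" where
  "var_occs (Var x) = [x]"
| "var_occs (App f ts) = concat (map var_occs ts)"

definition vars :: "'f trm \<Rightarrow> nat set" where
  "vars t = set (var_occs t)"

definition ground :: "'f trm \<Rightarrow> bool" where
  "ground t \<longleftrightarrow> vars t = {}"

fun subterms :: "'f trm \<Rightarrow> 'f trm set" where
  "subterms (Var x) = {Var x}"
| "subterms (App f ts) = insert (App f ts) (\<Union>t\<in>set ts. subterms t)"

fun subst :: "(nat \<Rightarrow> 'f trm) \<Rightarrow> 'f trm \<Rightarrow> 'f trm" where
  "subst \<sigma> (Var x) = \<sigma> x"
| "subst \<sigma> (App f ts) = App f (map (subst \<sigma>) ts)"

fun wf_trm :: "('f, 'p) signature \<Rightarrow> 'f trm \<Rightarrow> bool" where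
  "wf_trm \<Pi> (Var x) \<longleftrightarrow> True"
| "wf_trm \<Pi> (App f ts) \<longleftrightarrow>
     f \<in> funs \<Pi> \<and> length ts = farity \<Pi> f \<and> (\<forall>t\<in>set ts. wf_trm \<Pi> t)"

fun lit_trms :: "('f, 'p) literal \<Rightarrow> 'f trm set" where
  "lit_trms (Eq s t) = {s, t}"
| "lit_trms (Neq s t) = {s, t}"
| "lit_trms (Pos p ts) = set ts"
| "lit_trms (Neg p ts) = set ts"

fun lit_subst :: "(nat \<Rightarrow> 'f trm) \<Rightarrow> ('f, 'p) literal \<Rightarrow> ('f, 'p) literal" where
  "lit_subst \<sigma> (Eq s t) = Eq (subst \<sigma> s) (subst \<sigma> t)"
| "lit_subst \<sigma> (Neq s t) = Neq (subst \<sigma> s) (subst \<sigma> t)"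
| "lit_subst \<sigma> (Pos p ts) = Pos p (map (subst \<sigma>) ts)"
| "lit_subst \<sigma> (Neg p ts) = Neg p (map (subst \<sigma>) ts)"

fun wf_lit :: "('f, 'p) signature \<Rightarrow> ('f, 'p) literal \<Rightarrow> bool" where
  "wf_lit \<Pi> (Eq s t) \<longleftrightarrow> wf_trm \<Pi> s \<and> wf_trm \<Pi> t"
| "wf_lit \<Pi> (Neq s t) \<longleftrightarrow> wf_trm \<Pi> s \<and> wf_trm \<Pi> t"
| "wf_lit \<Pi> (Pos p ts) \<longleftrightarrow>
     p \<in> preds \<Pi> \<and> length ts = parity \<Pi> p \<and> (\<forall>t\<in>set ts. wf_trm \<Pi> t)"
| "wf_lit \<Pi> (Neg p ts) \<longleftrightarrow>
     p \<in> preds \<Pi> \<and> length ts = parity \<Pi> p \<and> (\<forall>t\<in>set ts. wf_trm \<Pi> t)"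

definition wf_clause :: "('f, 'p) signature \<Rightarrow> ('f, 'p) clause \<Rightarrow> bool" where
  "wf_clause \<Pi> c \<longleftrightarrow> (\<forall>l\<in>set c. wf_lit \<Pi> l)"

text \<open>All terms occurring in a clause, at any depth.\<close>
definition clause_subterms :: "('f, 'p) clause \<Rightarrow> 'f trm set" where
  "clause_subterms c = (\<Union>l\<in>set c. \<Union>t\<in>lit_trms l. subterms t)"

definition ground_clause :: "('f, 'p) clause \<Rightarrow> bool" where
  "ground_clause c \<longleftrightarrow> (\<forall>t\<in>clause_subterms c. ground t)"

fun wf_form :: "('f, 'p) signature \<Rightarrow> ('f, 'p) form \<Rightarrow> bool" where
  "wf_form \<Pi> Falsum \<longleftrightarrow> True"
| "wf_form \<Pi> (Equal s t) \<longleftrightarrow> wf_trm \<Pi> s \<and> wf_trm \<Pi> t"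
| "wf_form \<Pi> (Rel p ts) \<longleftrightarrow>
     p \<in> preds \<Pi> \<and> length ts = parity \<Pi> p \<and> (\<forall>t\<in>set ts. wf_trm \<Pi> t)"
| "wf_form \<Pi> (Imp \<phi> \<psi>) \<longleftrightarrow> wf_form \<Pi> \<phi> \<and> wf_form \<Pi> \<psi>"
| "wf_form \<Pi> (Forall x \<phi>) \<longleftrightarrow> wf_form \<Pi> \<phi>"

fun free_vars :: "('f, 'p) form \<Rightarrow> nat set" where
  "free_vars Falsum = {}"
| "free_vars (Equal s t) = vars s \<union> vars t"
| "free_vars (Rel p ts) = (\<Union>t\<in>set ts. vars t)"
| "free_vars (Imp \<phi> \<psi>) = free_vars \<phi> \<union> free_vars \<psi>"
| "free_vars (Forall x \<phi>) = free_vars \<phi> - {x}"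

definition first_order_theory :: "('f, 'p) signature \<Rightarrow> ('f, 'p) form set \<Rightarrow> bool" where
  "first_order_theory \<Pi> T \<longleftrightarrow> (\<forall>\<phi>\<in>T. wf_form \<Pi> \<phi> \<and> free_vars \<phi> = {})"


subsection \<open>Partial structures\<close>

text \<open>Structures interpret all symbols of the types \<open>'f\<close> and \<open>'p\<close>, but every notion below
  looks only at the symbols of an explicitly given signature. So one value is at the same time
  a structure over a signature and its own reduct to any smaller signature.\<close>
record ('f, 'p, 'u) pstruct =
  carrier :: "'u set"
  fint :: "'f \<Rightarrow> 'u list \<Rightarrow> 'u option"
  pint :: "'p \<Rightarrow> 'u list \<Rightarrow> bool"

definition tuples :: "('f, 'p, 'u) pstruct \<Rightarrow> nat \<Rightarrow> 'u list set" where
  "tuples A n = {as. length as = n \<and> set as \<subseteq> carrier A}"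

definition partial_structure :: "('f, 'p) signature \<Rightarrow> ('f, 'p, 'u) pstruct \<Rightarrow> bool" where
  "partial_structure \<Pi> A \<longleftrightarrow>
     carrier A \<noteq> {} \<and>
     (\<forall>f\<in>funs \<Pi>. \<forall>as b. fint A f as = Some b \<longrightarrow> as \<in> tuples A (farity \<Pi> f) \<and> b \<in> carrier A) \<and>
     (\<forall>p\<in>preds \<Pi>. \<forall>as. pint A p as \<longrightarrow> as \<in> tuples A (parity \<Pi> p))"

definition total_structure :: "('f, 'p) signature \<Rightarrow> ('f, 'p, 'u) pstruct \<Rightarrow> bool" where
  "total_structure \<Pi> A \<longleftrightarrow>
     partial_structure \<Pi> A \<and>
     (\<forall>f\<in>funs \<Pi>. \<forall>as\<in>tuples A (farity \<Pi> f). fint A f as \<noteq> None)"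

definition assignment :: "('f, 'p, 'u) pstruct \<Rightarrow> (nat \<Rightarrow> 'u) \<Rightarrow> bool" where
  "assignment A v \<longleftrightarrow> (\<forall>x. v x \<in> carrier A)"

fun eval :: "('f, 'p, 'u) pstruct \<Rightarrow> (nat \<Rightarrow> 'u) \<Rightarrow> 'f trm \<Rightarrow> 'u option" where
  "eval A v (Var x) = Some (v x)"
| "eval A v (App f ts) =
     (if \<exists>t\<in>set ts. eval A v t = None then None
      else fint A f (map (\<lambda>t. the (eval A v t)) ts))"

definition defined :: "('f, 'p, 'u) pstruct \<Rightarrow> (nat \<Rightarrow> 'u) \<Rightarrow> 'f trm \<Rightarrow> bool" where
  "defined A v t \<longleftrightarrow> eval A v t \<noteq> None"

text \<open>All involved terms are defined and the literal is true; in a total structure this is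
  ordinary satisfaction.\<close>
fun lit_true :: "('f, 'p, 'u) pstruct \<Rightarrow> (nat \<Rightarrow> 'u) \<Rightarrow> ('f, 'p) literal \<Rightarrow> bool" where
  "lit_true A v (Eq s t) \<longleftrightarrow> defined A v s \<and> defined A v t \<and> eval A v s = eval A v t"
| "lit_true A v (Neq s t) \<longleftrightarrow> defined A v s \<and> defined A v t \<and> eval A v s \<noteq> eval A v t"
| "lit_true A v (Pos p ts) \<longleftrightarrow>
     (\<forall>t\<in>set ts. defined A v t) \<and> pint A p (map (\<lambda>t. the (eval A v t)) ts)"
| "lit_true A v (Neg p ts) \<longleftrightarrow>
     (\<forall>t\<in>set ts. defined A v t) \<and> \<not> pint A p (map (\<lambda>t. the (eval A v t)) ts)"

definition lit_weak :: "('f, 'p, 'u) pstruct \<Rightarrow> (nat \<Rightarrow> 'u) \<Rightarrow> ('f, 'p) literal \<Rightarrow> bool" where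
  "lit_weak A v l \<longleftrightarrow> lit_true A v l \<or> (\<exists>t\<in>lit_trms l. \<not> defined A v t)"

definition satisfies :: "('f, 'p, 'u) pstruct \<Rightarrow> ('f, 'p) clause set \<Rightarrow> bool" where
  "satisfies A K \<longleftrightarrow> (\<forall>c\<in>K. \<forall>v. assignment A v \<longrightarrow> (\<exists>l\<in>set c. lit_true A v l))"

definition weakly_satisfies :: "('f, 'p, 'u) pstruct \<Rightarrow> ('f, 'p) clause set \<Rightarrow> bool" where
  "weakly_satisfies A K \<longleftrightarrow> (\<forall>c\<in>K. \<forall>v. assignment A v \<longrightarrow> (\<exists>l\<in>set c. lit_weak A v l))"

text \<open>Only used for structures in which the function symbols of the formula are total.\<close>
fun sat :: "('f, 'p, 'u) pstruct \<Rightarrow> (nat \<Rightarrow> 'u) \<Rightarrow> ('f, 'p) form \<Rightarrow> bool" where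
  "sat A v Falsum \<longleftrightarrow> False"
| "sat A v (Equal s t) \<longleftrightarrow> eval A v s = eval A v t"
| "sat A v (Rel p ts) \<longleftrightarrow> pint A p (map (\<lambda>t. the (eval A v t)) ts)"
| "sat A v (Imp \<phi> \<psi>) \<longleftrightarrow> (sat A v \<phi> \<longrightarrow> sat A v \<psi>)"
| "sat A v (Forall x \<phi>) \<longleftrightarrow> (\<forall>a\<in>carrier A. sat A (v(x := a)) \<phi>)"

definition models_theory :: "('f, 'p, 'u) pstruct \<Rightarrow> ('f, 'p) form set \<Rightarrow> bool" where
  "models_theory A T \<longleftrightarrow> (\<forall>\<phi>\<in>T. \<forall>v. assignment A v \<longrightarrow> sat A v \<phi>)"


subsection \<open>Theory extensions and condition \<open>Comp\<^sub>w\<close>\<close>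

definition theory_extension ::
  "('f, 'p) signature \<Rightarrow> 'f set \<Rightarrow> ('f, 'p) clause set \<Rightarrow> bool" where
  "theory_extension \<Pi>\<^sub>0 \<Sigma> K \<longleftrightarrow>
     \<Sigma> \<inter> funs \<Pi>\<^sub>0 = {} \<and> (\<forall>c\<in>K. wf_clause (sig_extend \<Pi>\<^sub>0 \<Sigma>) c)"

definition weak_partial_model ::
  "('f, 'p) signature \<Rightarrow> 'f set \<Rightarrow> ('f, 'p) form set \<Rightarrow> ('f, 'p) clause set
   \<Rightarrow> ('f, 'p, 'u) pstruct \<Rightarrow> bool" where
  "weak_partial_model \<Pi>\<^sub>0 \<Sigma> T\<^sub>0 K A \<longleftrightarrow>
     partial_structure (sig_extend \<Pi>\<^sub>0 \<Sigma>) A \<and>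
     total_structure \<Pi>\<^sub>0 A \<and> models_theory A T\<^sub>0 \<and>
     weakly_satisfies A K"

definition total_model ::
  "('f, 'p) signature \<Rightarrow> 'f set \<Rightarrow> ('f, 'p) form set \<Rightarrow> ('f, 'p) clause set
   \<Rightarrow> ('f, 'p, 'u) pstruct \<Rightarrow> bool" where
  "total_model \<Pi>\<^sub>0 \<Sigma> T\<^sub>0 K A \<longleftrightarrow>
     total_structure (sig_extend \<Pi>\<^sub>0 \<Sigma>) A \<and> models_theory A T\<^sub>0 \<and> satisfies A K"

definition weak_embedding ::
  "('f, 'p) signature \<Rightarrow> ('u \<Rightarrow> 'w) \<Rightarrow> ('f, 'p, 'u) pstruct \<Rightarrow> ('f, 'p, 'w) pstruct \<Rightarrow> bool" where
  "weak_embedding \<Pi> i A B \<longleftrightarrow>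
     inj_on i (carrier A) \<and> i ` carrier A \<subseteq> carrier B \<and>
     (\<forall>f\<in>funs \<Pi>. \<forall>as\<in>tuples A (farity \<Pi> f). \<forall>b.
        fint A f as = Some b \<longrightarrow> fint B f (map i as) = Some (i b)) \<and>
     (\<forall>p\<in>preds \<Pi>. \<forall>as\<in>tuples A (parity \<Pi> p). pint A p as \<longleftrightarrow> pint B p (map i as))"

definition isomorphism ::
  "('f, 'p) signature \<Rightarrow> ('u \<Rightarrow> 'w) \<Rightarrow> ('f, 'p, 'u) pstruct \<Rightarrow> ('f, 'p, 'w) pstruct \<Rightarrow> bool" where
  "isomorphism \<Pi> i A B \<longleftrightarrow>
     bij_betw i (carrier A) (carrier B) \<and>
     (\<forall>f\<in>funs \<Pi>. \<forall>as\<in>tuples A (farity \<Pi> f). fint B f (map i as) = map_option i (fint A f as)) \<and>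
     (\<forall>p\<in>preds \<Pi>. \<forall>as\<in>tuples A (parity \<Pi> p). pint A p as \<longleftrightarrow> pint B p (map i as))"

text \<open>The isomorphism between the \<open>\<Pi>\<^sub>0\<close>-reducts is the weak embedding itself.
  Structures have their carriers inside the type \<open>'u\<close>. Since \<open>B\<close> is in bijection with \<open>A\<close>,
  looking for \<open>B\<close> in the same type as \<open>A\<close> is no restriction.\<close>
definition comp_w ::
  "'u itself \<Rightarrow> ('f, 'p) signature \<Rightarrow> 'f set \<Rightarrow> ('f, 'p) form set \<Rightarrow> ('f, 'p) clause set \<Rightarrow> bool" where
  "comp_w (_ :: 'u itself) \<Pi>\<^sub>0 \<Sigma> T\<^sub>0 K \<longleftrightarrow>
     (\<forall>A :: ('f, 'p, 'u) pstruct. weak_partial_model \<Pi>\<^sub>0 \<Sigma> T\<^sub>0 K A \<longrightarrow>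
        (\<exists>(B :: ('f, 'p, 'u) pstruct) i.
           total_model \<Pi>\<^sub>0 \<Sigma> T\<^sub>0 K B \<and>
           weak_embedding (sig_extend \<Pi>\<^sub>0 \<Sigma>) i A B \<and>
           isomorphism \<Pi>\<^sub>0 i A B))"


subsection \<open>Locality\<close>

definition starts_with :: "'f set \<Rightarrow> 'f trm \<Rightarrow> bool" where
  "starts_with \<Sigma> t \<longleftrightarrow> (\<exists>f ts. t = App f ts \<and> f \<in> \<Sigma>)"

definition st :: "('f, 'p) clause set \<Rightarrow> ('f, 'p) clause set \<Rightarrow> 'f trm set" where
  "st K G = {t. ground t \<and> (\<exists>c\<in>K \<union> G. t \<in> clause_subterms c)}"

text \<open>\<open>instances \<Pi> \<Sigma> K G\<close> is \<open>K[G]\<close>, where \<open>\<Pi>\<close> is the full signature over which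
  instances are formed and \<open>\<Sigma>\<close> is the set of extension symbols. Instances need not be ground.\<close>
definition instances ::
  "('f, 'p) signature \<Rightarrow> 'f set \<Rightarrow> ('f, 'p) clause set \<Rightarrow> ('f, 'p) clause set
   \<Rightarrow> ('f, 'p) clause set" where
  "instances \<Pi> \<Sigma> K G =
     {map (lit_subst \<sigma>) c | c \<sigma>.
        c \<in> K \<and> (\<forall>x. wf_trm \<Pi> (\<sigma> x)) \<and>
        (\<forall>t\<in>clause_subterms (map (lit_subst \<sigma>) c). starts_with \<Sigma> t \<longrightarrow> ground t \<and> t \<in> st K G)}"

definition fresh_constants :: "('f, 'p) signature \<Rightarrow> 'f set \<Rightarrow> bool" where
  "fresh_constants \<Pi> C \<longleftrightarrow> C \<inter> funs \<Pi> = {} \<and> (\<forall>c\<in>C. farity \<Pi> c = 0)"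

text \<open>\<open>C\<close> is the set of additional constants in \<open>G\<close>. Entailment of falsity means having no
  model with carrier inside \<open>'u\<close>; by Loewenheim-Skolem this is entailment in the usual sense
  as soon as \<open>'u\<close> is infinite and at least as large as the language.\<close>
definition local_extension ::
  "'u itself \<Rightarrow> ('f, 'p) signature \<Rightarrow> 'f set \<Rightarrow> ('f, 'p) form set \<Rightarrow> ('f, 'p) clause set \<Rightarrow> bool" where
  "local_extension (_ :: 'u itself) \<Pi>\<^sub>0 \<Sigma> T\<^sub>0 K \<longleftrightarrow>
     (\<forall>C G. fresh_constants (sig_extend \<Pi>\<^sub>0 \<Sigma>) C \<and> finite G \<and>
        (\<forall>c\<in>G. wf_clause (sig_extend \<Pi>\<^sub>0 (\<Sigma> \<union> C)) c \<and> ground_clause c) \<longrightarrow>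
        ((\<nexists>A :: ('f, 'p, 'u) pstruct. total_model \<Pi>\<^sub>0 (\<Sigma> \<union> C) T\<^sub>0 (K \<union> G) A) \<longleftrightarrow>
         (\<nexists>A :: ('f, 'p, 'u) pstruct.
            weak_partial_model \<Pi>\<^sub>0 (\<Sigma> \<union> C) T\<^sub>0
              (instances (sig_extend \<Pi>\<^sub>0 (\<Sigma> \<union> C)) \<Sigma> K G \<union> G) A \<and>
            (\<forall>t\<in>st K G. \<forall>v. assignment A v \<longrightarrow> defined A v t))))"

definition flat_linear :: "'f set \<Rightarrow> ('f, 'p) clause \<Rightarrow> bool" where
  "flat_linear \<Sigma> c \<longleftrightarrow>
     (\<forall>f ts. App f ts \<in> clause_subterms c \<and> f \<in> \<Sigma> \<longrightarrow> (\<forall>t\<in>set ts. \<exists>x. t = Var x)) \<and>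
     (\<forall>s\<in>clause_subterms c. \<forall>t\<in>clause_subterms c.
        starts_with \<Sigma> s \<and> starts_with \<Sigma> t \<and> vars s \<inter> vars t \<noteq> {} \<longrightarrow> s = t) \<and>
     (\<forall>t\<in>clause_subterms c. starts_with \<Sigma> t \<longrightarrow> distinct (var_occs t))"

end

theory Submission
  imports Defs
begin

text \<open>
  Transporting structures along the isomorphism of the reducts, \<open>Comp\<^sub>w\<close> says that the partial
  extension functions of a weak partial model can be completed on the same carrier. For disjoint
  sets of extension symbols two such completions are glued into one, as no clause mentions symbols
  of both sets.

  For locality, let \<open>P\<close> be a weak partial model of \<open>K[G] \<union> G\<close> in which the terms of \<open>st K G\<close> are
  defined. Restrict every extension function to the argument tuples that are values of the
  arguments of a term of \<open>st K G\<close>. By flatness and linearity, an assignment under which all terms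
  of a clause of \<open>K\<close> are defined in the restricted structure is induced by a substitution that
  yields an instance in \<open>K[G]\<close>. Hence the restricted structure weakly satisfies \<open>K\<close>, and its
  completion is a total model of \<open>K \<union> G\<close>.
\<close>

section \<open>Terms and substitutions\<close>

lemma subterms_refl: "t \<in> subterms t"
  by (cases t) auto

lemma subterms_trans: "s \<in> subterms t \<Longrightarrow> t \<in> subterms u \<Longrightarrow> s \<in> subterms u"
  by (induction u) auto

lemma vars_subterm: "s \<in> subterms t \<Longrightarrow> vars s \<subseteq> vars t"
  by (induction t) (auto simp: vars_def)

lemma wf_trm_subterm: "s \<in> subterms t \<Longrightarrow> wf_trm \<Pi> t \<Longrightarrow> wf_trm \<Pi> s"
  by (induction t) auto

lemma wf_lit_trms: "wf_lit \<Pi> l \<Longrightarrow> t \<in> lit_trms l \<Longrightarrow> wf_trm \<Pi> t"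
  by (cases l) auto

lemma clause_subtermsI: "l \<in> set c \<Longrightarrow> t \<in> lit_trms l \<Longrightarrow> s \<in> subterms t \<Longrightarrow> s \<in> clause_subterms c"
  by (auto simp: clause_subterms_def)

lemma clause_subterms_subterm:
  "t \<in> clause_subterms c \<Longrightarrow> s \<in> subterms t \<Longrightarrow> s \<in> clause_subterms c"
  by (auto simp: clause_subterms_def intro: subterms_trans)

lemma wf_clause_subterm: "wf_clause \<Pi> c \<Longrightarrow> t \<in> clause_subterms c \<Longrightarrow> wf_trm \<Pi> t"
  by (auto simp: clause_subterms_def wf_clause_def intro: wf_trm_subterm dest: wf_lit_trms)

text \<open>Groundness is inherited by subterms. The closure carries the induction over terms in
  \<open>eval_restrict_to\<close> and covers extension terms that lie inside substituted
  terms.\<close>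

lemma st_subterm: "t \<in> st K G \<Longrightarrow> s \<in> subterms t \<Longrightarrow> s \<in> st K G"
  using vars_subterm by (fastforce simp: st_def ground_def intro: clause_subterms_subterm)

lemma wf_trm_st:
  assumes "\<And>c. c \<in> K \<Longrightarrow> wf_clause \<Pi> c" "\<And>c. c \<in> G \<Longrightarrow> wf_clause \<Pi> c" "t \<in> st K G"
  shows "wf_trm \<Pi> t"
proof -
  obtain c where "c \<in> K \<union> G" "t \<in> clause_subterms c" using assms(3) by (auto simp: st_def)
  then show ?thesis using assms(1,2) wf_clause_subterm[of \<Pi> c t] by blast
qed

lemma wf_trm_mono:
  "wf_trm \<Pi> t \<Longrightarrow> funs \<Pi> \<subseteq> funs \<Pi>' \<Longrightarrow> farity \<Pi>' = farity \<Pi> \<Longrightarrow> wf_trm \<Pi>' t"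
  by (induction t) auto

lemma wf_lit_mono:
  assumes "wf_lit \<Pi> l" "funs \<Pi> \<subseteq> funs \<Pi>'" "farity \<Pi>' = farity \<Pi>"
    "preds \<Pi>' = preds \<Pi>" "parity \<Pi>' = parity \<Pi>"
  shows "wf_lit \<Pi>' l"
  using assms by (cases l) (auto intro: wf_trm_mono)

lemma wf_clause_mono:
  assumes "wf_clause (sig_extend \<Pi> \<Sigma>) c" "\<Sigma> \<subseteq> \<Sigma>'"
  shows "wf_clause (sig_extend \<Pi> \<Sigma>') c"
proof -
  have "wf_lit (sig_extend \<Pi> \<Sigma>') l" if "wf_lit (sig_extend \<Pi> \<Sigma>) l" for l
    by (rule wf_lit_mono[OF that]) (use assms(2) in \<open>auto simp: sig_extend_def\<close>)
  with assms(1) show ?thesis by (simp add: wf_clause_def)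
qed

lemma lit_trms_subst: "lit_trms (lit_subst \<sigma> l) = subst \<sigma> ` lit_trms l"
  by (cases l) auto

lemma subterms_subst:
  assumes "t \<in> subterms (subst \<sigma> s)"
  shows "(\<exists>f ts. App f ts \<in> subterms s \<and> t = subst \<sigma> (App f ts)) \<or> (\<exists>x. t \<in> subterms (\<sigma> x))"
  using assms
proof (induction s)
  case (App f ts)
  then show ?case by fastforce
qed auto

text \<open>Serves to check the side condition of \<open>instances\<close>: a compound term of an
  instance is traced back to an application in the clause or into a term supplied by the
  substitution.\<close>

lemma clause_subterms_subst:
  assumes "t \<in> clause_subterms (map (lit_subst \<sigma>) c)"
  shows "(\<exists>f ts. App f ts \<in> clause_subterms c \<and> t = subst \<sigma> (App f ts)) \<or> (\<exists>x. t \<in> subterms (\<sigma> x))"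
proof -
  obtain l s where "l \<in> set c" "s \<in> lit_trms l" "t \<in> subterms (subst \<sigma> s)"
    using assms by (auto simp: clause_subterms_def lit_trms_subst)
  then show ?thesis
    using subterms_subst by (meson clause_subtermsI)
qed

section \<open>Evaluation\<close>

text \<open>Substitution lemma for partial evaluation. Since every \<open>\<sigma> x\<close> has a
  value, undefinedness arises at the same places on both sides.\<close>

lemma eval_subst:
  assumes "\<And>x. eval A v (\<sigma> x) = Some (w x)"
  shows "eval A v (subst \<sigma> t) = eval A w t"
proof (induction t)
  case (App f ts)
  then show ?case by (auto simp: comp_def cong: map_cong)
qed (simp add: assms)

lemma lit_true_subst:
  assumes "\<And>x. eval A v (\<sigma> x) = Some (w x)"
  shows "lit_true A v (lit_subst \<sigma> l) \<longleftrightarrow> lit_true A w l"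
  by (cases l) (simp_all add: eval_subst[of A v \<sigma> w, OF assms] defined_def comp_def)

lemma lit_weak_subst:
  assumes "\<And>x. eval A v (\<sigma> x) = Some (w x)"
  shows "lit_weak A v (lit_subst \<sigma> l) \<longleftrightarrow> lit_weak A w l"
  by (simp add: lit_weak_def lit_true_subst[of A v \<sigma> w, OF assms] lit_trms_subst
      eval_subst[of A v \<sigma> w, OF assms] defined_def)

lemma eval_vars_cong:
  assumes "\<And>x. x \<in> vars t \<Longrightarrow> v x = w x"
  shows "eval A v t = eval A w t"
  using assms
proof (induction t)
  case (App f ts)
  then have "eval A v t = eval A w t" if "t \<in> set ts" for t
    using that by (auto simp: vars_def)
  then show ?case by (auto cong: map_cong)
qed (simp add: vars_def)

lemma eval_ground: "ground t \<Longrightarrow> eval A v t = eval A w t"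
  by (rule eval_vars_cong) (simp add: ground_def)

text \<open>Structures interpret every symbol, so agreement on the function symbols of
  \<open>\<Pi>\<close> stands for having the same reduct. This lemma and the congruences after it
  replace the passage to reducts.\<close>

lemma eval_cong:
  assumes "wf_trm \<Pi> t" "\<And>f. f \<in> funs \<Pi> \<Longrightarrow> fint A f = fint B f"
  shows "eval A v t = eval B v t"
  using assms(1)
proof (induction t)
  case (App f ts)
  then have "eval A v t = eval B v t" if "t \<in> set ts" for t
    using that by auto
  with App.prems assms(2) show ?case by (auto cong: map_cong)
qed simp

lemma lit_true_cong:
  assumes "wf_lit \<Pi> l" "\<And>f. f \<in> funs \<Pi> \<Longrightarrow> fint A f = fint B f" "pint A = pint B"
  shows "lit_true A v l \<longleftrightarrow> lit_true B v l"
proof -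
  have "eval A v t = eval B v t" if "t \<in> lit_trms l" for t
    using eval_cong[of \<Pi> t A B v] wf_lit_trms[OF assms(1) that] assms(2) by blast
  then show ?thesis by (cases l) (auto simp: defined_def assms(3) cong: map_cong)
qed

lemma satisfies_cong:
  assumes "\<And>c. c \<in> K \<Longrightarrow> wf_clause \<Pi> c" "\<And>f. f \<in> funs \<Pi> \<Longrightarrow> fint A f = fint B f"
    "pint A = pint B" "carrier A = carrier B"
  shows "satisfies A K \<longleftrightarrow> satisfies B K"
proof -
  have "lit_true A v l \<longleftrightarrow> lit_true B v l" if "c \<in> K" "l \<in> set c" for c l v
    using that assms(1-3) by (intro lit_true_cong[of \<Pi>]) (auto simp: wf_clause_def)
  then show ?thesis by (simp add: satisfies_def assignment_def assms(4))
qed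

lemma sat_cong:
  assumes "wf_form \<Pi> \<phi>" "\<And>f. f \<in> funs \<Pi> \<Longrightarrow> fint A f = fint B f"
    "pint A = pint B" "carrier A = carrier B"
  shows "sat A v \<phi> \<longleftrightarrow> sat B v \<phi>"
  using assms(1)
proof (induction \<phi> arbitrary: v)
  case (Equal s t)
  then show ?case using eval_cong[of \<Pi> _ A B v] assms(2) by simp
next
  case (Rel p ts)
  then have "eval A v t = eval B v t" if "t \<in> set ts" for t
    using that eval_cong[of \<Pi> t A B v] assms(2) by simp
  then show ?case by (simp add: assms(3) cong: map_cong)
qed (simp_all add: assms(4))

lemma models_theory_cong:
  assumes "first_order_theory \<Pi> T" "\<And>f. f \<in> funs \<Pi> \<Longrightarrow> fint A f = fint B f"
    "pint A = pint B" "carrier A = carrier B"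
  shows "models_theory A T \<longleftrightarrow> models_theory B T"
proof -
  have "sat A v \<phi> \<longleftrightarrow> sat B v \<phi>" if "\<phi> \<in> T" for \<phi> v
    using that assms by (intro sat_cong[of \<Pi>]) (auto simp: first_order_theory_def)
  then show ?thesis by (simp add: models_theory_def assignment_def assms(4))
qed

text \<open>Induction on the term: definedness passes to the arguments, and the embedding carries
  over one function application at a time. Carrier membership is recorded because \<open>i\<close>
  is known to be injective only on \<open>carrier A\<close>.\<close>

lemma eval_weak_embedding:
  assumes emb: "weak_embedding \<Pi> i A B" and A: "partial_structure \<Pi> A" "assignment A v"
    and "wf_trm \<Pi> t" "eval A v t = Some a"
  shows "a \<in> carrier A \<and> eval B (i \<circ> v) t = Some (i a)"
  using assms(4,5)
proof (induction t arbitrary: a)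
  case (Var x)
  then show ?case using A(2) by (auto simp: assignment_def)
next
  case (App f ts)
  have def: "\<forall>t\<in>set ts. eval A v t \<noteq> None"
    and app: "fint A f (map (\<lambda>t. the (eval A v t)) ts) = Some a"
    using App.prems(2) by (auto split: if_splits)
  have arg: "eval B (i \<circ> v) t = Some (i (the (eval A v t)))" if "t \<in> set ts" for t
  proof -
    have "eval A v t \<noteq> None" using def that by blast
    then obtain b where "eval A v t = Some b" by blast
    from App.IH[OF that _ this] this App.prems(1) that show ?thesis by (simp del: o_apply add: o_def[symmetric])
  qed
  have map_eq: "map (\<lambda>t. the (eval B (i \<circ> v) t)) ts = map i (map (\<lambda>t. the (eval A v t)) ts)"
    using arg by simp
  have f: "f \<in> funs \<Pi>" using App.prems(1) by simp
  have tup: "map (\<lambda>t. the (eval A v t)) ts \<in> tuples A (farity \<Pi> f)" and a: "a \<in> carrier A"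
    using A(1) f app unfolding partial_structure_def by blast+
  have "fint B f (map i (map (\<lambda>t. the (eval A v t)) ts)) = Some (i a)"
    using emb f tup app unfolding weak_embedding_def by blast
  then have "eval B (i \<circ> v) (App f ts) = Some (i a)"
    unfolding map_eq[symmetric] using arg by simp
  with a show ?case by blast
qed

text \<open>Values are moved by \<open>i\<close>, so injectivity reflects equations, and atoms are
  preserved and reflected by the embedding. Definedness in \<open>A\<close> is assumed because
  \<open>B\<close> may define more terms.\<close>

lemma lit_true_weak_embedding:
  assumes emb: "weak_embedding \<Pi> i A B" and A: "partial_structure \<Pi> A" "assignment A v"
    and wf: "wf_lit \<Pi> l" and def: "\<forall>t\<in>lit_trms l. defined A v t"
  shows "lit_true B (i \<circ> v) l \<longleftrightarrow> lit_true A v l"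
proof -
  have ev: "the (eval A v t) \<in> carrier A \<and> eval A v t = Some (the (eval A v t)) \<and>
      eval B (i \<circ> v) t = Some (i (the (eval A v t)))"
    if t: "t \<in> lit_trms l" for t
  proof -
    obtain b where "eval A v t = Some b" using def t by (auto simp: defined_def)
    from eval_weak_embedding[OF emb A wf_lit_trms[OF wf t] this] this show ?thesis by simp
  qed
  have inj: "i a = i b \<longleftrightarrow> a = b" if "a \<in> carrier A" "b \<in> carrier A" for a b
    using emb that by (auto simp: weak_embedding_def inj_on_def)
  have eq: "eval B (i \<circ> v) s = eval B (i \<circ> v) t \<longleftrightarrow> eval A v s = eval A v t"
    if "s \<in> lit_trms l" "t \<in> lit_trms l" for s t
    using ev[OF that(1)] ev[OF that(2)] inj by (metis option.inject)
  have pr: "pint B p (map (\<lambda>t. the (eval B (i \<circ> v) t)) ts) \<longleftrightarrow> pint A p (map (\<lambda>t. the (eval A v t)) ts)"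
    if "p \<in> preds \<Pi>" "length ts = parity \<Pi> p" "set ts = lit_trms l" for p ts
  proof -
    have "map (\<lambda>t. the (eval B (i \<circ> v) t)) ts = map i (map (\<lambda>t. the (eval A v t)) ts)"
      using ev that(3) by simp
    moreover have "map (\<lambda>t. the (eval A v t)) ts \<in> tuples A (parity \<Pi> p)"
      using ev that(2,3) by (auto simp: tuples_def)
    ultimately show ?thesis using emb that(1) unfolding weak_embedding_def by metis
  qed
  have defB: "\<forall>t\<in>lit_trms l. defined B (i \<circ> v) t"
    using ev by (simp add: defined_def)
  show ?thesis
    using wf def defB eq pr by (cases l) auto
qed

lemma defined_total:
  assumes "total_structure \<Pi> A" "assignment A v" "wf_trm \<Pi> t"
  shows "\<exists>a\<in>carrier A. eval A v t = Some a"
  using assms(3)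
proof (induction t)
  case (Var x)
  then show ?case using assms(2) by (simp add: assignment_def)
next
  case (App f ts)
  have arg: "\<exists>a\<in>carrier A. eval A v t = Some a" if "t \<in> set ts" for t
    using App that by auto
  then have "map (\<lambda>t. the (eval A v t)) ts \<in> tuples A (farity \<Pi> f)"
    using App.prems by (fastforce simp: tuples_def)
  then have "fint A f (map (\<lambda>t. the (eval A v t)) ts) \<noteq> None"
    using assms(1) App.prems by (simp add: total_structure_def)
  then obtain b where b: "fint A f (map (\<lambda>t. the (eval A v t)) ts) = Some b" by blast
  moreover from b have "b \<in> carrier A"
    using assms(1) App.prems by (auto simp: total_structure_def partial_structure_def)
  moreover have "\<not> (\<exists>t\<in>set ts. eval A v t = None)" using arg by fastforce
  ultimately show ?case by simp
qed

section \<open>Completions on the same carrier\<close>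

text \<open>A weak embedding by the identity between equal carriers, stated for all symbols so that
  it serves every signature at once.\<close>

definition expands :: "('f, 'p, 'u) pstruct \<Rightarrow> ('f, 'p, 'u) pstruct \<Rightarrow> bool" where
  "expands B A \<longleftrightarrow> carrier B = carrier A \<and> pint B = pint A \<and> (\<forall>f. fint A f \<subseteq>\<^sub>m fint B f)"

lemma map_le_Some: "g \<subseteq>\<^sub>m h \<Longrightarrow> g x = Some y \<Longrightarrow> h x = Some y"
  by (metis domI map_le_def)

lemma expands_weak_embedding: "expands B A \<Longrightarrow> weak_embedding \<Pi> id A B"
  by (auto simp: expands_def weak_embedding_def intro: map_le_Some)

text \<open>The functions of the model supplied by \<open>comp_w\<close> are pulled back along the
  bijection \<open>i\<close>; they extend those of \<open>A\<close> because \<open>i\<close> is a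
  weak embedding. Leaving the symbols outside \<open>\<Sigma>\<close> untouched is what later allows
  two completions to be glued and additional constants to be kept.\<close>

lemma comp_w_expansion:
  fixes A :: "('f, 'p, 'u) pstruct"
  assumes fot: "first_order_theory \<Pi>\<^sub>0 T\<^sub>0" and ext: "theory_extension \<Pi>\<^sub>0 \<Sigma> K"
    and comp: "comp_w TYPE('u) \<Pi>\<^sub>0 \<Sigma> T\<^sub>0 K" and wpm: "weak_partial_model \<Pi>\<^sub>0 \<Sigma> T\<^sub>0 K A"
  shows "\<exists>B. expands B A \<and> (\<forall>f. f \<notin> \<Sigma> \<longrightarrow> fint B f = fint A f) \<and> total_model \<Pi>\<^sub>0 \<Sigma> T\<^sub>0 K B"
proof -
  let ?\<Pi> = "sig_extend \<Pi>\<^sub>0 \<Sigma>"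
  obtain B :: "('f, 'p, 'u) pstruct" and i where B: "total_model \<Pi>\<^sub>0 \<Sigma> T\<^sub>0 K B" and emb: "weak_embedding ?\<Pi> i A B"
    and iso: "isomorphism \<Pi>\<^sub>0 i A B"
    using comp wpm unfolding comp_w_def by blast
  have psA: "partial_structure ?\<Pi> A" and tsA: "total_structure \<Pi>\<^sub>0 A" and mtA: "models_theory A T\<^sub>0"
    using wpm by (auto simp: weak_partial_model_def)
  have tsB: "total_structure ?\<Pi> B" and satB: "satisfies B K"
    using B by (auto simp: total_model_def)
  have bij: "bij_betw i (carrier A) (carrier B)" using iso by (simp add: isomorphism_def)
  define j where "j = inv_into (carrier A) i"
  have ij: "i (j b) = b" "j b \<in> carrier A" if "b \<in> carrier B" for b
    using bij that by (auto simp: j_def bij_betw_def f_inv_into_f inv_into_into)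
  have ji: "j (i a) = a" if "a \<in> carrier A" for a
    using bij that by (auto simp: j_def bij_betw_def)
  have tup: "map i as \<in> tuples B n" if "as \<in> tuples A n" for as n
    using that bij by (auto simp: tuples_def bij_betw_def)
  \<comment> \<open>The test on \<open>tuples\<close> matters: outside the carrier \<open>i\<close>
    is arbitrary and may produce arguments on which \<open>B\<close> is defined, while a partial
    structure must be undefined there. The symbols of \<open>\<Pi>\<^sub>0\<close> can stay as in
    \<open>A\<close> since \<open>i\<close> is an isomorphism of the reducts.\<close>
  define D where "D = A\<lparr>fint := \<lambda>f as. if f \<in> \<Sigma> then
      (if as \<in> tuples A (farity \<Pi>\<^sub>0 f) then map_option j (fint B f (map i as)) else None)
      else fint A f as\<rparr>"
  have [simp]: "carrier D = carrier A" "pint D = pint A" "tuples D = tuples A"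
    by (auto simp: D_def tuples_def)
  have old: "fint D f = fint A f" if "f \<notin> \<Sigma>" for f
    using that by (auto simp: D_def)
  have new: "fint D f as = (if as \<in> tuples A (farity \<Pi>\<^sub>0 f)
      then map_option j (fint B f (map i as)) else None)" if "f \<in> \<Sigma>" for f as
    using that by (simp add: D_def)
  have disj: "f \<notin> \<Sigma>" if "f \<in> funs \<Pi>\<^sub>0" for f
    using ext that by (auto simp: theory_extension_def)
  have Bval: "\<exists>b\<in>carrier B. fint B f as = Some b"
    if "f \<in> \<Sigma>" "as \<in> tuples B (farity \<Pi>\<^sub>0 f)" for f as
    using tsB that by (fastforce simp: total_structure_def partial_structure_def sig_extend_def)
  have le: "fint A f \<subseteq>\<^sub>m fint D f" for f
  proof (cases "f \<in> \<Sigma>")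
    case True
    have "fint D f as = Some b" if ab: "fint A f as = Some b" for as b
    proof -
      have t: "as \<in> tuples A (farity \<Pi>\<^sub>0 f)" and b: "b \<in> carrier A"
        using psA True ab by (auto simp: partial_structure_def sig_extend_def)
      have "fint B f (map i as) = Some (i b)"
        using emb True t ab by (auto simp: weak_embedding_def sig_extend_def)
      then show ?thesis using new[OF True] t ji[OF b] by simp
    qed
    then show ?thesis by (auto simp: map_le_def dom_def)
  qed (simp add: old)
  then have exp: "expands D A" by (simp add: expands_def)
  have psD: "partial_structure ?\<Pi> D"
    unfolding partial_structure_def
  proof (intro conjI ballI allI impI)
    show "carrier D \<noteq> {}" using psA by (simp add: partial_structure_def)
  next
    fix f as b assume f: "f \<in> funs ?\<Pi>" and ab: "fint D f as = Some b"
    have "as \<in> tuples A (farity \<Pi>\<^sub>0 f) \<and> b \<in> carrier A"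
    proof (cases "f \<in> \<Sigma>")
      case True
      then have t: "as \<in> tuples A (farity \<Pi>\<^sub>0 f)" and b: "map_option j (fint B f (map i as)) = Some b"
        using ab new by (auto split: if_splits)
      obtain b' where "b' \<in> carrier B" "fint B f (map i as) = Some b'"
        using Bval[OF True tup[OF t]] by blast
      then show ?thesis using t b ij by auto
    next
      case False
      then have "fint A f as = Some b" using ab by (simp add: old)
      then show ?thesis using f psA unfolding partial_structure_def by (auto simp: sig_extend_def)
    qed
    then show "as \<in> tuples D (farity ?\<Pi> f)" "b \<in> carrier D" by (simp_all add: sig_extend_def)
  next
    fix p as assume "p \<in> preds ?\<Pi>" "pint D p as"
    then show "as \<in> tuples D (parity ?\<Pi> p)" using psA by (simp add: partial_structure_def)
  qed
  have tsD: "total_structure ?\<Pi> D"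
    unfolding total_structure_def
  proof (intro conjI ballI psD)
    fix f as assume f: "f \<in> funs ?\<Pi>" and as: "as \<in> tuples D (farity ?\<Pi> f)"
    then have t: "as \<in> tuples A (farity \<Pi>\<^sub>0 f)" by (simp add: sig_extend_def)
    show "fint D f as \<noteq> None"
    proof (cases "f \<in> \<Sigma>")
      case True
      then show ?thesis using new[OF True] t Bval[OF True tup[OF t]] by auto
    next
      case False
      then show ?thesis using f t tsA by (auto simp: old total_structure_def sig_extend_def)
    qed
  qed
  have embD: "weak_embedding ?\<Pi> i D B"
    unfolding weak_embedding_def
  proof (intro conjI ballI allI impI)
    show "inj_on i (carrier D)" "i ` carrier D \<subseteq> carrier B" using bij by (auto simp: bij_betw_def)
  next
    fix f as b
    assume f: "f \<in> funs ?\<Pi>" and as: "as \<in> tuples D (farity ?\<Pi> f)" and ab: "fint D f as = Some b"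
    then have t: "as \<in> tuples A (farity \<Pi>\<^sub>0 f)" by (simp add: sig_extend_def)
    show "fint B f (map i as) = Some (i b)"
    proof (cases "f \<in> \<Sigma>")
      case True
      then show ?thesis using new[OF True] t Bval[OF True tup[OF t]] ab ij by auto
    next
      case False
      then show ?thesis using f t ab emb by (auto simp: old weak_embedding_def sig_extend_def)
    qed
  next
    fix p as assume "p \<in> preds ?\<Pi>" "as \<in> tuples D (parity ?\<Pi> p)"
    then show "pint D p as \<longleftrightarrow> pint B p (map i as)" using emb by (simp add: weak_embedding_def)
  qed
  \<comment> \<open>Truth in \<open>B\<close> under \<open>i \<circ> v\<close> is reflected to
    \<open>D\<close>, because \<open>i\<close> embeds all of \<open>D\<close> and totality of
    \<open>D\<close> makes every term of the clause defined.\<close>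
  have "satisfies D K"
    unfolding satisfies_def
  proof (intro ballI allI impI)
    fix c v assume c: "c \<in> K" and v: "assignment D v"
    have "assignment B (i \<circ> v)"
      using v bij by (auto simp: assignment_def bij_betw_def)
    then obtain l where l: "l \<in> set c" "lit_true B (i \<circ> v) l"
      using satB c by (auto simp: satisfies_def)
    have wf: "wf_lit ?\<Pi> l" using ext c l(1) by (auto simp: theory_extension_def wf_clause_def)
    have "\<forall>t\<in>lit_trms l. defined D v t"
      using defined_total[OF tsD v wf_lit_trms[OF wf]] by (fastforce simp: defined_def)
    with lit_true_weak_embedding[OF embD psD v wf] l show "\<exists>l\<in>set c. lit_true D v l" by blast
  qed
  moreover have "models_theory D T\<^sub>0"
    using mtA models_theory_cong[OF fot, of D A] old disj by simp
  ultimately have "total_model \<Pi>\<^sub>0 \<Sigma> T\<^sub>0 K D" using tsD by (simp add: total_model_def)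
  with exp old show ?thesis by blast
qed

section \<open>Gluing completions for disjoint extension symbols\<close>

lemma total_structure_cong:
  assumes "total_structure \<Pi> A" "\<And>f. f \<in> funs \<Pi> \<Longrightarrow> fint A f = fint B f"
    "pint A = pint B" "carrier A = carrier B"
  shows "total_structure \<Pi> B"
  using assms by (auto simp: total_structure_def partial_structure_def tuples_def)

lemma partial_structure_mono:
  assumes "partial_structure (sig_extend \<Pi> \<Sigma>) A" "\<Sigma>' \<subseteq> \<Sigma>"
  shows "partial_structure (sig_extend \<Pi> \<Sigma>') A"
  using assms unfolding partial_structure_def sig_extend_def by simp blast

lemma total_structure_Un:
  assumes "total_structure (sig_extend \<Pi> \<Sigma>) A" "total_structure (sig_extend \<Pi> \<Sigma>') A"
  shows "total_structure (sig_extend \<Pi> (\<Sigma> \<union> \<Sigma>')) A"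
  using assms unfolding total_structure_def partial_structure_def sig_extend_def by simp blast

lemma weak_partial_model_mono:
  assumes "weak_partial_model \<Pi>\<^sub>0 \<Sigma> T\<^sub>0 K A" "\<Sigma>' \<subseteq> \<Sigma>" "K' \<subseteq> K"
  shows "weak_partial_model \<Pi>\<^sub>0 \<Sigma>' T\<^sub>0 K' A"
  using assms partial_structure_mono[of \<Pi>\<^sub>0 \<Sigma> A \<Sigma>']
  by (auto simp: weak_partial_model_def weakly_satisfies_def)

lemma comp_w_union:
  fixes \<Pi>\<^sub>0 :: "('f, 'p) signature"
  assumes fot: "first_order_theory \<Pi>\<^sub>0 T\<^sub>0"
    and ext1: "theory_extension \<Pi>\<^sub>0 \<Sigma>\<^sub>1 K\<^sub>1" and ext2: "theory_extension \<Pi>\<^sub>0 \<Sigma>\<^sub>2 K\<^sub>2"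
    and comp1: "comp_w TYPE('u) \<Pi>\<^sub>0 \<Sigma>\<^sub>1 T\<^sub>0 K\<^sub>1" and comp2: "comp_w TYPE('u) \<Pi>\<^sub>0 \<Sigma>\<^sub>2 T\<^sub>0 K\<^sub>2"
    and disj: "\<Sigma>\<^sub>1 \<inter> \<Sigma>\<^sub>2 = {}"
  shows "comp_w TYPE('u) \<Pi>\<^sub>0 (\<Sigma>\<^sub>1 \<union> \<Sigma>\<^sub>2) T\<^sub>0 (K\<^sub>1 \<union> K\<^sub>2)"
  unfolding comp_w_def
proof (intro allI impI)
  fix A :: "('f, 'p, 'u) pstruct"
  assume wpm: "weak_partial_model \<Pi>\<^sub>0 (\<Sigma>\<^sub>1 \<union> \<Sigma>\<^sub>2) T\<^sub>0 (K\<^sub>1 \<union> K\<^sub>2) A"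
  \<comment> \<open>A weak partial model of the union is one of each single extension, once the
    symbols and clauses of the other are forgotten.\<close>
  obtain B1 where B1: "expands B1 A" "\<And>f. f \<notin> \<Sigma>\<^sub>1 \<Longrightarrow> fint B1 f = fint A f"
      "total_model \<Pi>\<^sub>0 \<Sigma>\<^sub>1 T\<^sub>0 K\<^sub>1 B1"
    using comp_w_expansion[OF fot ext1 comp1] weak_partial_model_mono[OF wpm] by (meson Un_upper1)
  obtain B2 where B2: "expands B2 A" "\<And>f. f \<notin> \<Sigma>\<^sub>2 \<Longrightarrow> fint B2 f = fint A f"
      "total_model \<Pi>\<^sub>0 \<Sigma>\<^sub>2 T\<^sub>0 K\<^sub>2 B2"
    using comp_w_expansion[OF fot ext2 comp2] weak_partial_model_mono[OF wpm] by (meson Un_upper2)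
  \<comment> \<open>\<open>B2\<close> agrees with \<open>A\<close> outside
    \<open>\<Sigma>\<^sub>2\<close>, so the second branch also supplies the symbols of
    \<open>\<Pi>\<^sub>0\<close> unchanged.\<close>
  define B where "B = A\<lparr>fint := \<lambda>f. if f \<in> \<Sigma>\<^sub>1 then fint B1 f else fint B2 f\<rparr>"
  have BA: "carrier B = carrier A" "pint B = pint A" by (simp_all add: B_def)
  have eqs: "carrier B1 = carrier B" "pint B1 = pint B" "carrier B2 = carrier B" "pint B2 = pint B"
    using B1(1) B2(1) by (simp_all add: BA expands_def)
  have d: "f \<notin> \<Sigma>\<^sub>1" "f \<notin> \<Sigma>\<^sub>2" if "f \<in> funs \<Pi>\<^sub>0" for f
    using ext1 ext2 that by (auto simp: theory_extension_def)
  have eq1: "fint B1 f = fint B f" if "f \<in> funs (sig_extend \<Pi>\<^sub>0 \<Sigma>\<^sub>1)" for f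
    using that d B1(2) B2(2) by (auto simp: B_def sig_extend_def)
  \<comment> \<open>Disjointness enters here: a symbol of \<open>\<Sigma>\<^sub>2\<close> must not
    be interpreted by \<open>B1\<close>.\<close>
  have eq2: "fint B2 f = fint B f" if "f \<in> funs (sig_extend \<Pi>\<^sub>0 \<Sigma>\<^sub>2)" for f
    using that d disj by (auto simp: B_def sig_extend_def)
  have eq0: "fint B f = fint A f" if "f \<in> funs \<Pi>\<^sub>0" for f
    using that d B2(2) by (simp add: B_def)
  have exp: "expands B A"
    using B1(1) B2(1) by (auto simp: expands_def B_def)
  have "total_structure (sig_extend \<Pi>\<^sub>0 \<Sigma>\<^sub>1) B" "total_structure (sig_extend \<Pi>\<^sub>0 \<Sigma>\<^sub>2) B"
    using total_structure_cong[of _ B1 B] total_structure_cong[of _ B2 B] B1(3) B2(3) eq1 eq2 eqs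
    by (auto simp: total_model_def)
  then have ts: "total_structure (sig_extend \<Pi>\<^sub>0 (\<Sigma>\<^sub>1 \<union> \<Sigma>\<^sub>2)) B"
    by (rule total_structure_Un)
  have "satisfies B K\<^sub>1"
    using satisfies_cong[of K\<^sub>1 "sig_extend \<Pi>\<^sub>0 \<Sigma>\<^sub>1" B1 B] ext1 eq1 eqs B1(3)
    by (auto simp: theory_extension_def total_model_def)
  moreover have "satisfies B K\<^sub>2"
    using satisfies_cong[of K\<^sub>2 "sig_extend \<Pi>\<^sub>0 \<Sigma>\<^sub>2" B2 B] ext2 eq2 eqs B2(3)
    by (auto simp: theory_extension_def total_model_def)
  ultimately have satB: "satisfies B (K\<^sub>1 \<union> K\<^sub>2)" by (auto simp: satisfies_def)
  have "models_theory B T\<^sub>0"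
    using wpm models_theory_cong[OF fot, of B A] eq0 BA by (simp add: weak_partial_model_def)
  with ts satB have tm: "total_model \<Pi>\<^sub>0 (\<Sigma>\<^sub>1 \<union> \<Sigma>\<^sub>2) T\<^sub>0 (K\<^sub>1 \<union> K\<^sub>2) B" by (simp add: total_model_def)
  have "isomorphism \<Pi>\<^sub>0 id A B"
    by (simp add: isomorphism_def BA eq0 option.map_id)
  with tm expands_weak_embedding[OF exp]
  show "\<exists>(B :: ('f, 'p, 'u) pstruct) i. total_model \<Pi>\<^sub>0 (\<Sigma>\<^sub>1 \<union> \<Sigma>\<^sub>2) T\<^sub>0 (K\<^sub>1 \<union> K\<^sub>2) B \<and>
      weak_embedding (sig_extend \<Pi>\<^sub>0 (\<Sigma>\<^sub>1 \<union> \<Sigma>\<^sub>2)) i A B \<and> isomorphism \<Pi>\<^sub>0 i A B"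
    by blast
qed

section \<open>Locality\<close>

text \<open>By well-formedness, a symbol of \<open>\<Sigma>'\<close> occurring in the clause already
  lies in \<open>\<Sigma>\<close>, so the larger set singles out the same extension terms.\<close>

lemma flat_linear_extend:
  assumes "flat_linear \<Sigma> c" "wf_clause (sig_extend \<Pi>\<^sub>0 \<Sigma>) c" "\<Sigma>' \<inter> funs \<Pi>\<^sub>0 = {}"
  shows "flat_linear (\<Sigma> \<union> \<Sigma>') c"
proof -
  have sym: "f \<in> \<Sigma>" if "App f ts \<in> clause_subterms c" "f \<in> \<Sigma> \<union> \<Sigma>'" for f ts
    using wf_clause_subterm[OF assms(2) that(1)] that(2) assms(3) by (auto simp: sig_extend_def)
  have sw: "starts_with \<Sigma> t" if "t \<in> clause_subterms c" "starts_with (\<Sigma> \<union> \<Sigma>') t" for t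
    using that sym unfolding starts_with_def by blast
  show ?thesis
    unfolding flat_linear_def
  proof (intro conjI)
    show "\<forall>f ts. App f ts \<in> clause_subterms c \<and> f \<in> \<Sigma> \<union> \<Sigma>' \<longrightarrow> (\<forall>t\<in>set ts. \<exists>x. t = Var x)"
      using assms(1) sym unfolding flat_linear_def by blast
    show "\<forall>s\<in>clause_subterms c. \<forall>t\<in>clause_subterms c. starts_with (\<Sigma> \<union> \<Sigma>') s \<and>
        starts_with (\<Sigma> \<union> \<Sigma>') t \<and> vars s \<inter> vars t \<noteq> {} \<longrightarrow> s = t"
      using assms(1) sw unfolding flat_linear_def by simp
    show "\<forall>t\<in>clause_subterms c. starts_with (\<Sigma> \<union> \<Sigma>') t \<longrightarrow> distinct (var_occs t)"
      using assms(1) sw unfolding flat_linear_def by simp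
  qed
qed

section \<open>Restricting a structure to the argument values of given terms\<close>

text \<open>\<open>S\<close> is meant to consist of ground terms, for which the choice of \<open>v\<close> is irrelevant.\<close>
definition restrict_to :: "'f set \<Rightarrow> 'f trm set \<Rightarrow> ('f, 'p, 'u) pstruct \<Rightarrow> ('f, 'p, 'u) pstruct" where
  "restrict_to \<Sigma> S P = P\<lparr>fint := \<lambda>f as.
     if f \<in> \<Sigma> \<longrightarrow> (\<exists>ts. App f ts \<in> S \<and> (\<forall>v. map (eval P v) ts = map Some as))
     then fint P f as else None\<rparr>"

lemma restrict_to_sel [simp]:
  "carrier (restrict_to \<Sigma> S P) = carrier P" "pint (restrict_to \<Sigma> S P) = pint P"
  "f \<notin> \<Sigma> \<Longrightarrow> fint (restrict_to \<Sigma> S P) f = fint P f"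
  by (simp_all add: restrict_to_def)

lemma fint_restrict_to_eq:
  "fint (restrict_to \<Sigma> S P) f as =
    (if f \<in> \<Sigma> \<longrightarrow> (\<exists>ts. App f ts \<in> S \<and> (\<forall>v. map (eval P v) ts = map Some as))
     then fint P f as else None)"
  by (simp add: restrict_to_def)

lemma fint_restrict_to: "fint (restrict_to \<Sigma> S P) f as = Some b \<Longrightarrow> fint P f as = Some b"
  by (simp add: restrict_to_def split: if_split_asm)

lemma expands_restrict_to: "expands P (restrict_to \<Sigma> S P)"
  by (simp add: expands_def map_le_def dom_def) (metis fint_restrict_to)

lemma partial_structure_restrict_to:
  assumes "partial_structure \<Pi> P"
  shows "partial_structure \<Pi> (restrict_to \<Sigma> S P)"
  using assms fint_restrict_to[of \<Sigma> S P] unfolding partial_structure_def tuples_def by simp blast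

text \<open>For \<open>App f ts\<close> in \<open>S\<close> the arguments keep their values by
  induction, and the term itself witnesses that its argument tuple is retained. Groundness makes
  these values the same under all assignments, as the restriction demands.\<close>

lemma eval_restrict_to:
  assumes "t \<in> S" "\<And>t. t \<in> S \<Longrightarrow> ground t" "\<And>t s. t \<in> S \<Longrightarrow> s \<in> subterms t \<Longrightarrow> s \<in> S"
    "\<And>t. t \<in> S \<Longrightarrow> defined P v t"
  shows "eval (restrict_to \<Sigma> S P) v t = eval P v t"
  using assms(1)
proof (induction t)
  case (App f ts)
  have S: "t \<in> S" if "t \<in> set ts" for t
    using assms(3)[OF App.prems, of t] that subterms_refl[of t] by auto
  have eq: "eval (restrict_to \<Sigma> S P) v t = eval P v t" if "t \<in> set ts" for t
    using App.IH[OF that S[OF that]] .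
  have val: "eval P w t = Some (the (eval P v t))" if "t \<in> set ts" for t w
  proof -
    have "eval P w t = eval P v t" using assms(2)[OF S[OF that]] by (rule eval_ground)
    moreover have "eval P v t \<noteq> None" using assms(4)[OF S[OF that]] by (simp add: defined_def)
    ultimately show ?thesis by (metis option.collapse)
  qed
  have "map (eval P w) ts = map Some (map (\<lambda>t. the (eval P v t)) ts)" for w
    unfolding map_map comp_def by (rule map_cong[OF refl val])
  then have witness: "f \<in> \<Sigma> \<longrightarrow> (\<exists>us. App f us \<in> S \<and>
      (\<forall>w. map (eval P w) us = map Some (map (\<lambda>t. the (eval P v t)) ts)))"
    using App.prems by blast
  have "fint (restrict_to \<Sigma> S P) f (map (\<lambda>t. the (eval P v t)) ts)
      = fint P f (map (\<lambda>t. the (eval P v t)) ts)"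
    unfolding fint_restrict_to_eq by (rule if_P[OF witness])
  with eq show ?case by (auto cong: map_cong)
qed simp

section \<open>Matching substitutions for flat and linear clauses\<close>

lemma eval_App_vars:
  assumes "\<forall>t\<in>set ts. \<exists>x. t = Var x" "defined A v (App f ts)"
  obtains xs where "ts = map Var xs" "fint A f (map v xs) \<noteq> None"
proof -
  \<comment> \<open>Each argument is a variable and contributes a one-element list, so the
    concatenation recovers the argument variables in order.\<close>
  define xs where "xs = concat (map var_occs ts)"
  have "ts = map Var xs"
    unfolding xs_def using assms(1) by (induction ts) auto
  moreover from this have "fint A f (map v xs) \<noteq> None"
    using assms(2) by (simp add: defined_def comp_def split: if_splits)
  ultimately show ?thesis using that by blast
qed

lemma var_occs_App_Var: "var_occs (App f (map Var xs)) = xs"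
  by (induction xs) auto

text \<open>Linearity makes the matching substitutions of the individual extension terms compatible.\<close>
lemma flat_linear_matching:
  assumes fl: "flat_linear \<Sigma> c"
    and def: "\<And>f ts. App f ts \<in> clause_subterms c \<Longrightarrow> f \<in> \<Sigma> \<Longrightarrow> defined (restrict_to \<Sigma> S P) v (App f ts)"
  obtains \<sigma> where
    "\<And>x. eval P v (\<sigma> x) = Some (v x)"
    "\<And>x. \<sigma> x = Var x \<or> (\<exists>t\<in>S. \<sigma> x \<in> subterms t)"
    "\<And>f ts. App f ts \<in> clause_subterms c \<Longrightarrow> f \<in> \<Sigma> \<Longrightarrow> subst \<sigma> (App f ts) \<in> S"
proof -
  \<comment> \<open>Definedness in the restricted structure yields a term \<open>App f us\<close> of
    \<open>S\<close> whose arguments have the values of \<open>xs\<close> under \<open>v\<close>.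
    The terms \<open>us\<close> are the intended images of the variables \<open>xs\<close>.\<close>
  have "\<exists>xs us. ts = map Var xs \<and> length us = length xs \<and> distinct xs \<and> App f us \<in> S \<and>
      map (eval P v) us = map (\<lambda>x. Some (v x)) xs"
    if t: "App f ts \<in> clause_subterms c" "f \<in> \<Sigma>" for f ts
  proof -
    have "\<forall>t\<in>set ts. \<exists>x. t = Var x" using fl t by (auto simp: flat_linear_def)
    from eval_App_vars[OF this def[OF t]] obtain xs where xs: "ts = map Var xs"
      and ne: "fint (restrict_to \<Sigma> S P) f (map v xs) \<noteq> None" by blast
    obtain us where us: "App f us \<in> S" "\<forall>v'. map (eval P v') us = map Some (map v xs)"
      using ne t(2) unfolding fint_restrict_to_eq by (metis (no_types, lifting))
    have m: "map (eval P v) us = map (\<lambda>x. Some (v x)) xs" using us(2) by (simp add: comp_def)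
    have "distinct (var_occs (App f ts))"
      using fl t unfolding flat_linear_def starts_with_def by blast
    then have "distinct xs" unfolding xs var_occs_App_Var .
    with xs us(1) m show ?thesis using map_eq_imp_length_eq[OF m] by blast
  qed
  then obtain X U where XU_all: "\<And>f ts. App f ts \<in> clause_subterms c \<Longrightarrow> f \<in> \<Sigma> \<Longrightarrow>
      ts = map Var (X f ts) \<and> length (U f ts) = length (X f ts) \<and> distinct (X f ts) \<and>
      App f (U f ts) \<in> S \<and> map (eval P v) (U f ts) = map (\<lambda>x. Some (v x)) (X f ts)"
    by metis
  have ts_eq: "ts = map Var (X f ts)" if "App f ts \<in> clause_subterms c" "f \<in> \<Sigma>" for f ts
    using XU_all[OF that] by (rule conjunct1)
  have XU: "length (U f ts) = length (X f ts)" "distinct (X f ts)" "App f (U f ts) \<in> S"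
    "map (eval P v) (U f ts) = map (\<lambda>x. Some (v x)) (X f ts)"
    if "App f ts \<in> clause_subterms c" "f \<in> \<Sigma>" for f ts
    using XU_all[OF that] by blast+
  \<comment> \<open>Positions of a variable directly below an extension symbol. The image of the
    variable is read off at such a position, so it must be shown to be unique.\<close>
  define occ where "occ x f ts n \<longleftrightarrow>
      App f ts \<in> clause_subterms c \<and> f \<in> \<Sigma> \<and> n < length (X f ts) \<and> X f ts ! n = x" for x f ts n
  have varX: "vars (App f ts) = set (X f ts)" if "App f ts \<in> clause_subterms c" "f \<in> \<Sigma>" for f ts
  proof -
    have "var_occs (App f ts) = var_occs (App f (map Var (X f ts)))"
      using ts_eq[OF that] by (rule arg_cong)
    then show ?thesis unfolding vars_def var_occs_App_Var by (rule arg_cong)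
  qed
  \<comment> \<open>A shared variable forces the two extension terms to be identical; distinctness
    of the variables within one term then forces equal positions.\<close>
  have uniq: "f = g \<and> ts = us \<and> n = m" if o: "occ x f ts n" "occ x g us m" for x f ts n g us m
  proof -
    have "x \<in> set (X f ts)" "x \<in> set (X g us)"
      using o unfolding occ_def in_set_conv_nth by blast+
    then have "vars (App f ts) \<inter> vars (App g us) \<noteq> {}"
      using varX[of f ts] varX[of g us] o by (auto simp: occ_def)
    then have "App f ts = App g us"
      using fl o unfolding flat_linear_def starts_with_def occ_def by blast
    then show ?thesis using o XU(2)[of f ts] by (auto simp: occ_def nth_eq_iff_index_eq)
  qed
  \<comment> \<open>Variables that occur below no extension symbol are left alone. They evaluate to
    \<open>v x\<close> anyway, and instances may be non-ground.\<close>
  define \<sigma> where "\<sigma> x = (if \<exists>f ts n. occ x f ts n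
      then (SOME u. \<exists>f ts n. occ x f ts n \<and> u = U f ts ! n) else Var x)" for x
  have \<sigma>_occ: "\<sigma> x = U f ts ! n" if o: "occ x f ts n" for x f ts n
  proof -
    have "(SOME u. \<exists>f ts n. occ x f ts n \<and> u = U f ts ! n) = U f ts ! n"
      using o uniq by (intro some_equality) blast+
    then show ?thesis using o by (auto simp: \<sigma>_def)
  qed
  show ?thesis
  proof (rule that[of \<sigma>])
    fix x
    show "eval P v (\<sigma> x) = Some (v x)"
    proof (cases "\<exists>f ts n. occ x f ts n")
      case True
      then obtain f ts n where o: "occ x f ts n" by blast
      then have n: "n < length (X f ts)" "X f ts ! n = x" "n < length (U f ts)"
        and "map (eval P v) (U f ts) = map (\<lambda>x. Some (v x)) (X f ts)"
        using XU(1,4)[of f ts] by (auto simp: occ_def)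
      then have "eval P v (U f ts ! n) = Some (v x)" by (metis nth_map)
      then show ?thesis using \<sigma>_occ[OF o] by simp
    qed (simp add: \<sigma>_def)
    show "\<sigma> x = Var x \<or> (\<exists>t\<in>S. \<sigma> x \<in> subterms t)"
    proof (cases "\<exists>f ts n. occ x f ts n")
      case True
      then obtain f ts n where o: "occ x f ts n" by blast
      then have "U f ts ! n \<in> set (U f ts)" and S: "App f (U f ts) \<in> S"
        using XU(1,3)[of f ts] by (auto simp: occ_def)
      then have "U f ts ! n \<in> subterms (App f (U f ts))" using subterms_refl[of "U f ts ! n"] by auto
      then show ?thesis unfolding \<sigma>_occ[OF o] using S by blast
    qed (simp add: \<sigma>_def)
  next
    fix f ts assume t: "App f ts \<in> clause_subterms c" "f \<in> \<Sigma>"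
    have "map (subst \<sigma>) ts = map \<sigma> (X f ts)"
      using arg_cong[OF ts_eq[OF t], of "map (subst \<sigma>)"] by (simp add: comp_def)
    also have "\<dots> = U f ts"
      using XU(1)[OF t] t by (intro nth_equalityI) (auto intro!: \<sigma>_occ simp: occ_def)
    finally show "subst \<sigma> (App f ts) \<in> S" using XU(3)[OF t] by simp
  qed
qed

lemma weakly_satisfies_restrict_to:
  fixes P :: "('f, 'p, 'u) pstruct"
  assumes fl: "\<And>c. c \<in> K \<Longrightarrow> flat_linear \<Sigma> c"
    and wfK: "\<And>c. c \<in> K \<Longrightarrow> wf_clause \<Pi> c" and wfG: "\<And>c. c \<in> G \<Longrightarrow> wf_clause \<Pi> c"
    and ps: "partial_structure \<Pi> P" and sat: "weakly_satisfies P (instances \<Pi> \<Sigma> K G)"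
  shows "weakly_satisfies (restrict_to \<Sigma> (st K G) P) K"
  unfolding weakly_satisfies_def
proof (intro ballI allI impI)
  fix c v
  let ?A = "restrict_to \<Sigma> (st K G) P"
  assume c: "c \<in> K" and v: "assignment ?A v"
  show "\<exists>l\<in>set c. lit_weak ?A v l"
  \<comment> \<open>A literal with an undefined term holds weakly, so a matching instance is needed
    only if all terms of the clause are defined.\<close>
  proof (cases "\<forall>l\<in>set c. \<forall>t\<in>lit_trms l. defined ?A v t")
    case False
    then show ?thesis by (auto simp: lit_weak_def)
  next
    case True
    have sub: "defined ?A v s" if "s \<in> subterms t" "defined ?A v t" for s t
      using that by (induction t) (auto simp: defined_def split: if_splits)
    have "defined ?A v t" if "t \<in> clause_subterms c" for t
      using that True sub by (auto simp: clause_subterms_def)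
    then obtain \<sigma> where \<sigma>: "\<And>x. eval P v (\<sigma> x) = Some (v x)"
      "\<And>x. \<sigma> x = Var x \<or> (\<exists>t\<in>st K G. \<sigma> x \<in> subterms t)"
      "\<And>f ts. App f ts \<in> clause_subterms c \<Longrightarrow> f \<in> \<Sigma> \<Longrightarrow> subst \<sigma> (App f ts) \<in> st K G"
      using flat_linear_matching[OF fl[OF c], of "st K G" P v] by metis
    have wf_st: "wf_trm \<Pi> t" if "t \<in> st K G" for t
      using wfK wfG that by (rule wf_trm_st)
    have wf\<sigma>: "wf_trm \<Pi> (\<sigma> x)" for x
      using \<sigma>(2)[of x] wf_st wf_trm_subterm by (metis wf_trm.simps(1))
    \<comment> \<open>An extension term of the instance is either the image of one in
      \<open>c\<close>, which the matching sends into \<open>st K G\<close>, or a subterm of some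
      \<open>\<sigma> x\<close>; there a bare variable is excluded and closure under subterms
      applies.\<close>
    have "t \<in> st K G" if "t \<in> clause_subterms (map (lit_subst \<sigma>) c)" "starts_with \<Sigma> t" for t
      using clause_subterms_subst[OF that(1)]
    proof (elim disjE exE conjE)
      fix f ts assume "App f ts \<in> clause_subterms c" "t = subst \<sigma> (App f ts)"
      then show ?thesis using that(2) \<sigma>(3) by (auto simp: starts_with_def)
    next
      fix x assume x: "t \<in> subterms (\<sigma> x)"
      show ?thesis using \<sigma>(2)[of x]
      proof
        assume "\<sigma> x = Var x"
        then show ?thesis using x that(2) by (auto simp: starts_with_def)
      next
        assume "\<exists>t\<in>st K G. \<sigma> x \<in> subterms t"
        then show ?thesis using x st_subterm by meson
      qed
    qed
    then have "map (lit_subst \<sigma>) c \<in> instances \<Pi> \<Sigma> K G"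
      using c wf\<sigma> by (force simp: instances_def st_def)
    moreover have "assignment P v" using v by (simp add: assignment_def)
    ultimately obtain l where l: "l \<in> set c" "lit_weak P v (lit_subst \<sigma> l)"
      using sat by (fastforce simp: weakly_satisfies_def)
    \<comment> \<open>Since \<open>\<sigma> x\<close> has the value \<open>v x\<close> under
      \<open>v\<close>, the instance and the original clause agree literal by literal under the same
      assignment.\<close>
    have P: "lit_weak P v l" using l(2) lit_weak_subst[of P v \<sigma> v l] \<sigma>(1) by blast
    have emb: "weak_embedding \<Pi> id ?A P" by (rule expands_weak_embedding[OF expands_restrict_to])
    have psA: "partial_structure \<Pi> ?A" by (rule partial_structure_restrict_to[OF ps])
    have wfl: "wf_lit \<Pi> l" using wfK[OF c] l(1) by (simp add: wf_clause_def)
    have "defined P v t" if t: "t \<in> lit_trms l" for t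
    proof -
      obtain a where "eval ?A v t = Some a" using True l(1) t by (auto simp: defined_def)
      with eval_weak_embedding[OF emb psA v wf_lit_trms[OF wfl t] this] show ?thesis
        by (simp add: defined_def)
    qed
    then have "lit_true P v l" using P by (auto simp: lit_weak_def)
    then have "lit_true ?A v l"
      using lit_true_weak_embedding[OF emb psA v wfl] True l(1) by simp
    then show ?thesis using l(1) by (auto simp: lit_weak_def)
  qed
qed

section \<open>The two directions of locality\<close>

text \<open>The easy direction, with the structure unchanged: the values of the
  \<open>\<sigma> x\<close> form an assignment \<open>w\<close>, and a literal of the original
  clause true under \<open>w\<close> gives a true literal of the instance.\<close>

lemma total_model_weak_instances:
  fixes A :: "('f, 'p, 'u) pstruct"
  assumes wfK: "\<And>c. c \<in> K \<Longrightarrow> wf_clause (sig_extend \<Pi>\<^sub>0 \<Delta>) c"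
    and wfG: "\<And>c. c \<in> G \<Longrightarrow> wf_clause (sig_extend \<Pi>\<^sub>0 \<Delta>) c"
    and tm: "total_model \<Pi>\<^sub>0 \<Delta> T\<^sub>0 (K \<union> G) A"
  shows "weak_partial_model \<Pi>\<^sub>0 \<Delta> T\<^sub>0 (instances (sig_extend \<Pi>\<^sub>0 \<Delta>) \<Sigma> K G \<union> G) A"
    and "t \<in> st K G \<Longrightarrow> assignment A v \<Longrightarrow> defined A v t"
proof -
  let ?\<Pi> = "sig_extend \<Pi>\<^sub>0 \<Delta>"
  have ts: "total_structure ?\<Pi> A" and sat: "satisfies A (K \<union> G)"
    using tm by (auto simp: total_model_def)
  have "\<exists>l\<in>set d. lit_weak A v l"
    if d: "d \<in> instances ?\<Pi> \<Sigma> K G" and v: "assignment A v" for d v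
  proof -
    obtain c \<sigma> where c: "c \<in> K" "d = map (lit_subst \<sigma>) c" "\<And>x. wf_trm ?\<Pi> (\<sigma> x)"
      using d by (auto simp: instances_def)
    have "\<forall>x. \<exists>a. a \<in> carrier A \<and> eval A v (\<sigma> x) = Some a"
      using defined_total[OF ts v c(3)] by blast
    then obtain w where w: "\<And>x. w x \<in> carrier A" "\<And>x. eval A v (\<sigma> x) = Some (w x)"
      by metis
    then obtain l where "l \<in> set c" "lit_true A w l"
      using sat c(1) unfolding satisfies_def assignment_def by blast
    then show ?thesis
      using lit_true_subst[of A v \<sigma> w l, OF w(2)] c(2) by (auto simp: lit_weak_def)
  qed
  moreover have "weakly_satisfies A G"
    using sat by (fastforce simp: satisfies_def weakly_satisfies_def lit_weak_def)
  ultimately have "weakly_satisfies A (instances ?\<Pi> \<Sigma> K G \<union> G)"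
    by (auto simp: weakly_satisfies_def)
  moreover have "total_structure \<Pi>\<^sub>0 A"
    using ts by (auto simp: total_structure_def partial_structure_def sig_extend_def)
  ultimately show "weak_partial_model \<Pi>\<^sub>0 \<Delta> T\<^sub>0 (instances ?\<Pi> \<Sigma> K G \<union> G) A"
    using tm by (auto simp: weak_partial_model_def total_model_def total_structure_def)
  show "defined A v t" if "t \<in> st K G" "assignment A v"
  proof -
    have "wf_trm ?\<Pi> t" using wfK wfG that(1) by (rule wf_trm_st)
    from defined_total[OF ts that(2) this] show ?thesis by (auto simp: defined_def)
  qed
qed

text \<open>\<open>comp_w\<close> concerns only the symbols of \<open>\<Sigma>\<close>, so the
  restricted structure is completed without regard to \<open>C\<close>. The additional constants
  keep their meaning because the completion leaves symbols outside \<open>\<Sigma>\<close>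
  unchanged; undefined ones receive an arbitrary value afterwards.\<close>

lemma weak_instances_total_model:
  fixes P :: "('f, 'p, 'u) pstruct"
  assumes fot: "first_order_theory \<Pi>\<^sub>0 T\<^sub>0" and ext: "theory_extension \<Pi>\<^sub>0 \<Sigma> K"
    and comp: "comp_w TYPE('u) \<Pi>\<^sub>0 \<Sigma> T\<^sub>0 K" and fl: "\<And>c. c \<in> K \<Longrightarrow> flat_linear \<Sigma> c"
    and fresh: "fresh_constants (sig_extend \<Pi>\<^sub>0 \<Sigma>) C"
    and G: "\<And>c. c \<in> G \<Longrightarrow> wf_clause (sig_extend \<Pi>\<^sub>0 (\<Sigma> \<union> C)) c" "\<And>c. c \<in> G \<Longrightarrow> ground_clause c"
    and wpm: "weak_partial_model \<Pi>\<^sub>0 (\<Sigma> \<union> C) T\<^sub>0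
      (instances (sig_extend \<Pi>\<^sub>0 (\<Sigma> \<union> C)) \<Sigma> K G \<union> G) P"
    and def: "\<And>t v. t \<in> st K G \<Longrightarrow> assignment P v \<Longrightarrow> defined P v t"
  shows "\<exists>B :: ('f, 'p, 'u) pstruct. total_model \<Pi>\<^sub>0 (\<Sigma> \<union> C) T\<^sub>0 (K \<union> G) B"
proof -
  let ?\<Pi> = "sig_extend \<Pi>\<^sub>0 (\<Sigma> \<union> C)"
  let ?A = "restrict_to \<Sigma> (st K G) P"
  have ps: "partial_structure ?\<Pi> P" and ts: "total_structure \<Pi>\<^sub>0 P" and mt: "models_theory P T\<^sub>0"
    and ws: "weakly_satisfies P (instances ?\<Pi> \<Sigma> K G)" and wsG: "weakly_satisfies P G"
    using wpm by (auto simp: weak_partial_model_def weakly_satisfies_def)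
  have wfK0: "wf_clause (sig_extend \<Pi>\<^sub>0 \<Sigma>) c" if "c \<in> K" for c
    using ext that by (simp add: theory_extension_def)
  then have wfK: "wf_clause ?\<Pi> c" if "c \<in> K" for c
    using that by (blast intro: wf_clause_mono)
  have disj: "f \<notin> \<Sigma>" if "f \<in> funs \<Pi>\<^sub>0" for f
    using ext that by (auto simp: theory_extension_def)
  have C: "c \<notin> funs \<Pi>\<^sub>0" "c \<notin> \<Sigma>" "farity \<Pi>\<^sub>0 c = 0" if "c \<in> C" for c
    using fresh that by (auto simp: fresh_constants_def sig_extend_def)
  have psA: "partial_structure ?\<Pi> ?A" by (rule partial_structure_restrict_to[OF ps])
  have "weakly_satisfies ?A K"
    by (rule weakly_satisfies_restrict_to[OF fl wfK G(1) ps ws])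
  moreover have "total_structure \<Pi>\<^sub>0 ?A"
    using total_structure_cong[OF ts, of ?A] disj by simp
  moreover have "models_theory ?A T\<^sub>0"
    using mt models_theory_cong[OF fot, of ?A P] disj by simp
  moreover have "partial_structure (sig_extend \<Pi>\<^sub>0 \<Sigma>) ?A"
    using psA by (rule partial_structure_mono) simp
  ultimately have "weak_partial_model \<Pi>\<^sub>0 \<Sigma> T\<^sub>0 K ?A" by (simp add: weak_partial_model_def)
  then obtain D where D: "expands D ?A" "\<And>f. f \<notin> \<Sigma> \<Longrightarrow> fint D f = fint ?A f"
      "total_model \<Pi>\<^sub>0 \<Sigma> T\<^sub>0 K D"
    using comp_w_expansion[OF fot ext comp] by blast
  obtain e where e: "e \<in> carrier P" using ps by (auto simp: partial_structure_def)
  \<comment> \<open>Additional constants that do not occur in \<open>G\<close> may be undefined in \<open>P\<close>.\<close>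
  define B where "B = D\<lparr>fint := \<lambda>f as. if f \<in> C \<and> as = [] \<and> fint D f as = None
      then Some e else fint D f as\<rparr>"
  have BP: "carrier D = carrier P" "pint D = pint P" "carrier B = carrier P" "pint B = pint P"
    using D(1) by (simp_all add: expands_def B_def)
  have BD: "fint D f = fint B f" if "f \<in> funs (sig_extend \<Pi>\<^sub>0 \<Sigma>)" for f
  proof -
    have "f \<notin> C" using that C(1,2) unfolding sig_extend_def by auto
    then show ?thesis by (simp add: B_def)
  qed
  have tsD: "total_structure (sig_extend \<Pi>\<^sub>0 \<Sigma>) D" using D(3) by (simp add: total_model_def)
  have tsB0: "total_structure (sig_extend \<Pi>\<^sub>0 \<Sigma>) B"
    using total_structure_cong[OF tsD, of B] BD BP by simp
  have CB: "(as \<in> tuples B 0 \<longrightarrow> fint B c as \<noteq> None) \<and>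
      (\<forall>b. fint B c as = Some b \<longrightarrow> as \<in> tuples B 0 \<and> b \<in> carrier B)" if c: "c \<in> C" for c as
  proof -
    have "fint D c as = fint P c as" using D(2) C(2)[OF c] by simp
    moreover have "as \<in> tuples P 0 \<and> b \<in> carrier P" if "fint P c as = Some b" for b
    proof -
      have "c \<in> funs ?\<Pi>" "farity ?\<Pi> c = 0" using c C(3)[OF c] by (simp_all add: sig_extend_def)
      then show ?thesis using ps that unfolding partial_structure_def by metis
    qed
    ultimately show ?thesis using c e by (auto simp: B_def BP tuples_def)
  qed
  have tsB: "total_structure ?\<Pi> B"
  proof -
    have "funs ?\<Pi> = funs (sig_extend \<Pi>\<^sub>0 \<Sigma>) \<union> C" "farity ?\<Pi> = farity (sig_extend \<Pi>\<^sub>0 \<Sigma>)"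
      "preds ?\<Pi> = preds (sig_extend \<Pi>\<^sub>0 \<Sigma>)" "parity ?\<Pi> = parity (sig_extend \<Pi>\<^sub>0 \<Sigma>)"
      by (auto simp: sig_extend_def)
    moreover have "farity (sig_extend \<Pi>\<^sub>0 \<Sigma>) c = 0" if "c \<in> C" for c
      using C(3)[OF that] by (simp add: sig_extend_def)
    ultimately show ?thesis
      using tsB0 CB unfolding total_structure_def partial_structure_def by (metis Un_iff)
  qed
  \<comment> \<open>The clauses of \<open>K\<close> contain no additional constants, so assigning
    values to these does not affect them.\<close>
  have satK: "satisfies B K"
    using satisfies_cong[of K "sig_extend \<Pi>\<^sub>0 \<Sigma>" D B] wfK0 BD BP D(3) by (simp add: total_model_def)
  have mtB: "models_theory B T\<^sub>0"
    using models_theory_cong[OF fot, of D B] BD BP D(3) by (simp add: total_model_def sig_extend_def)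
  have "fint D f \<subseteq>\<^sub>m fint B f" for f
    by (auto simp: B_def map_le_def)
  then have "expands B ?A"
    using D(1) by (auto simp: expands_def BP intro: map_le_trans)
  \<comment> \<open>\<open>P\<close> itself need not embed into \<open>B\<close>, since the
    completion may choose other values where the restriction removed some. The restricted structure
    embeds into both and mediates the truth of literals of \<open>G\<close>.\<close>
  then have embB: "weak_embedding ?\<Pi> id ?A B" by (rule expands_weak_embedding)
  have embP: "weak_embedding ?\<Pi> id ?A P" by (rule expands_weak_embedding[OF expands_restrict_to])
  have "satisfies B G"
    unfolding satisfies_def
  proof (intro ballI allI impI)
    fix c v assume c: "c \<in> G" and "assignment B v"
    then have v: "assignment P v" "assignment ?A v" by (simp_all add: assignment_def BP)
    obtain l where l: "l \<in> set c" "lit_weak P v l"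
      using wsG c v(1) by (auto simp: weakly_satisfies_def)
    have wfl: "wf_lit ?\<Pi> l" using G(1)[OF c] l(1) by (simp add: wf_clause_def)
    have st: "t \<in> st K G" if "t \<in> lit_trms l" for t
      using clause_subtermsI[OF l(1) that subterms_refl] G(2)[OF c] c
      by (auto simp: st_def ground_clause_def)
    \<comment> \<open>All terms of \<open>G\<close> are ground and hence belong to
      \<open>st K G\<close>, so the restriction neither removes nor changes their values.\<close>
    have "eval ?A v t = eval P v t" if "t \<in> st K G" for t
      using that _ st_subterm def[OF _ v(1)] by (rule eval_restrict_to) (simp add: st_def)
    then have dA: "\<forall>t\<in>lit_trms l. defined ?A v t"
      using st def[OF _ v(1)] by (simp add: defined_def)
    have "lit_true P v l" using l(2) st def[OF _ v(1)] by (auto simp: lit_weak_def)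
    then have "lit_true B v l"
      using lit_true_weak_embedding[OF embP psA v(2) wfl dA]
        lit_true_weak_embedding[OF embB psA v(2) wfl dA] by simp
    with l(1) show "\<exists>l\<in>set c. lit_true B v l" by blast
  qed
  with satK have "satisfies B (K \<union> G)" by (auto simp: satisfies_def)
  with tsB mtB show ?thesis by (auto simp: total_model_def)
qed

lemma comp_w_imp_local:
  fixes \<Pi>\<^sub>0 :: "('f, 'p) signature"
  assumes fot: "first_order_theory \<Pi>\<^sub>0 T\<^sub>0" and ext: "theory_extension \<Pi>\<^sub>0 \<Sigma> K"
    and comp: "comp_w TYPE('u) \<Pi>\<^sub>0 \<Sigma> T\<^sub>0 K" and fl: "\<And>c. c \<in> K \<Longrightarrow> flat_linear \<Sigma> c"
  shows "local_extension TYPE('u) \<Pi>\<^sub>0 \<Sigma> T\<^sub>0 K"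
  unfolding local_extension_def
proof (intro allI impI, elim conjE)
  fix C :: "'f set" and G :: "('f, 'p) clause set"
  let ?\<Pi> = "sig_extend \<Pi>\<^sub>0 (\<Sigma> \<union> C)"
  assume fresh: "fresh_constants (sig_extend \<Pi>\<^sub>0 \<Sigma>) C"
    and G: "\<forall>c\<in>G. wf_clause ?\<Pi> c \<and> ground_clause c"
  have wfG: "wf_clause ?\<Pi> c" "ground_clause c" if "c \<in> G" for c
    using G that by auto
  have wfK: "wf_clause ?\<Pi> c" if "c \<in> K" for c
    using ext that by (auto simp: theory_extension_def intro: wf_clause_mono)
  show "(\<nexists>A :: ('f, 'p, 'u) pstruct. total_model \<Pi>\<^sub>0 (\<Sigma> \<union> C) T\<^sub>0 (K \<union> G) A) \<longleftrightarrow>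
      (\<nexists>A :: ('f, 'p, 'u) pstruct.
        weak_partial_model \<Pi>\<^sub>0 (\<Sigma> \<union> C) T\<^sub>0 (instances ?\<Pi> \<Sigma> K G \<union> G) A \<and>
        (\<forall>t\<in>st K G. \<forall>v. assignment A v \<longrightarrow> defined A v t))"
    (is "(\<nexists>A. ?total A) \<longleftrightarrow> (\<nexists>A. ?weak A \<and> ?def A)")
  proof -
    \<comment> \<open>Both sides deny the existence of a model, so it suffices to obtain a model of
      either kind from one of the other.\<close>
    have "?weak A \<and> ?def A" if "?total A" for A
      using total_model_weak_instances[OF wfK wfG(1) that] by blast
    moreover have "\<exists>B. ?total B" if "?weak A" "?def A" for A
      using that by (intro weak_instances_total_model[OF fot ext comp fl fresh wfG]) blast+
    ultimately show ?thesis by blast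
  qed
qed

theorem theorem3:
  fixes \<Pi>\<^sub>0 :: "('f, 'p) signature"
    and \<Sigma>\<^sub>1 \<Sigma>\<^sub>2 :: "'f set"
    and T\<^sub>0 :: "('f, 'p) form set"
    and K\<^sub>1 K\<^sub>2 :: "('f, 'p) clause set"
  assumes "first_order_theory \<Pi>\<^sub>0 T\<^sub>0"
    and "theory_extension \<Pi>\<^sub>0 \<Sigma>\<^sub>1 K\<^sub>1"
    and "theory_extension \<Pi>\<^sub>0 \<Sigma>\<^sub>2 K\<^sub>2"
    and "comp_w TYPE('u) \<Pi>\<^sub>0 \<Sigma>\<^sub>1 T\<^sub>0 K\<^sub>1"
    and "comp_w TYPE('u) \<Pi>\<^sub>0 \<Sigma>\<^sub>2 T\<^sub>0 K\<^sub>2"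
    and "\<Sigma>\<^sub>1 \<inter> \<Sigma>\<^sub>2 = {}"
  shows "comp_w TYPE('u) \<Pi>\<^sub>0 (\<Sigma>\<^sub>1 \<union> \<Sigma>\<^sub>2) T\<^sub>0 (K\<^sub>1 \<union> K\<^sub>2) \<and>
         ((\<forall>c\<in>K\<^sub>1. flat_linear \<Sigma>\<^sub>1 c) \<and> (\<forall>c\<in>K\<^sub>2. flat_linear \<Sigma>\<^sub>2 c) \<longrightarrow>
            local_extension TYPE('u) \<Pi>\<^sub>0 (\<Sigma>\<^sub>1 \<union> \<Sigma>\<^sub>2) T\<^sub>0 (K\<^sub>1 \<union> K\<^sub>2))"
proof (intro conjI impI)
  show comp: "comp_w TYPE('u) \<Pi>\<^sub>0 (\<Sigma>\<^sub>1 \<union> \<Sigma>\<^sub>2) T\<^sub>0 (K\<^sub>1 \<union> K\<^sub>2)"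
    by (rule comp_w_union[OF assms])
  assume fl: "(\<forall>c\<in>K\<^sub>1. flat_linear \<Sigma>\<^sub>1 c) \<and> (\<forall>c\<in>K\<^sub>2. flat_linear \<Sigma>\<^sub>2 c)"
  have ext: "theory_extension \<Pi>\<^sub>0 (\<Sigma>\<^sub>1 \<union> \<Sigma>\<^sub>2) (K\<^sub>1 \<union> K\<^sub>2)"
    using assms(2,3) by (auto simp: theory_extension_def intro: wf_clause_mono)
  \<comment> \<open>Flatness and linearity are given for each clause set with respect to its own
    symbols; they carry over to the union because the symbols of the other extension are not in
    \<open>\<Pi>\<^sub>0\<close>.\<close>
  have "flat_linear (\<Sigma>\<^sub>1 \<union> \<Sigma>\<^sub>2) c" if "c \<in> K\<^sub>1 \<union> K\<^sub>2" for c
    using that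
  proof
    assume "c \<in> K\<^sub>1"
    then show ?thesis
      using fl assms(2,3) by (intro flat_linear_extend[of _ _ \<Pi>\<^sub>0]) (auto simp: theory_extension_def)
  next
    assume "c \<in> K\<^sub>2"
    then have "flat_linear (\<Sigma>\<^sub>2 \<union> \<Sigma>\<^sub>1) c"
      using fl assms(2,3) by (intro flat_linear_extend[of _ _ \<Pi>\<^sub>0]) (auto simp: theory_extension_def)
    then show ?thesis by (simp add: Un_commute)
  qed
  then show "local_extension TYPE('u) \<Pi>\<^sub>0 (\<Sigma>\<^sub>1 \<union> \<Sigma>\<^sub>2) T\<^sub>0 (K\<^sub>1 \<union> K\<^sub>2)"
    by (rule comp_w_imp_local[OF assms(1) ext comp])
qed

end
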